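(* Let $X_n$ be a random vector in $\mathbb{R}^d$ for each $n\in\mathbb{N}\cup\{\infty\}$. Suppose that there is a non-empty open subset $U\subseteq\mathbb{R}^d$ such that $\lim_{n\to\infty}M_{X_n}(s)=M_{X_\infty}(s)$ for all $s\in U$. Then $X_n$ converges in distribution to $X_\infty$.
   Context: For a random vector $X$ taking values in $\mathbb{R}^d$, its moment generating function is defined as $M_X(s)=\mathbf{E}[e^{\langle s,X\rangle}]$, $s\in\mathbb{R}^d$.
   Formalization: The limit moment generating function M_{X_∞}(s) is assumed finite for all s in U; if infinite values were allowed the claim fails (e.g. X_n Cauchy and X_∞ a shifted Cauchy, with all generating functions infinite on U = (0,1)). *)

theory Defs
  imports "HOL-Probability.Probability" "HOL-Library.Extended_Nat"
begin

(* Extended-valued: the expectation of a nonnegative variable always exists in [0, \<infinity>].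
   The Bochner integral would return 0 where the expectation is infinite. *)
definition mgf :: "'w measure \<Rightarrow> ('w \<Rightarrow> 'v::real_inner) \<Rightarrow> 'v \<Rightarrow> ennreal"
  where "mgf M X s = (\<integral>\<^sup>+ w. ennreal (exp (s \<bullet> X w)) \<partial>M)"

(* The library's weak_conv_m covers only measures on the real line; this is the usual definition
   by bounded continuous test functions. The variables may live on different probability spaces. *)
definition converges_in_distribution ::
  "(nat \<Rightarrow> 'w measure) \<Rightarrow> (nat \<Rightarrow> 'w \<Rightarrow> 'v::topological_space) \<Rightarrow> 'u measure \<Rightarrow> ('u \<Rightarrow> 'v) \<Rightarrow> bool"
  where "converges_in_distribution M X N Y \<longleftrightarrow>
    (\<forall>f :: 'v \<Rightarrow> real. continuous_on UNIV f \<longrightarrow> bounded (range f) \<longrightarrow>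
      (\<lambda>n. \<integral>w. f (X n w) \<partial>M n) \<longlonglongrightarrow> (\<integral>w. f (Y w) \<partial>N))"

end

theory Submission
  imports Defs
begin

text \<open>
  Fix a point \<open>a\<close> of the open set \<open>U\<close>. The idea is to obtain characteristic functions of the tilted
  laws \<open>e\<^sup>a\<^sup>x \<mu>\<^sub>n(dx)\<close> by analytic continuation of their moment generating functions, to pass from
  characters to continuous test functions, and to undo the tilt on compactly supported ones.
  Each of these steps approximates test functions uniformly with respect to one weight.

  For small \<open>\<rho> > 0\<close> the weight \<open>W x = exp (a \<bullet> x + \<rho> * norm x)\<close> is dominated by a finite sum of
  exponentials \<open>exp (s \<bullet> x)\<close> with \<open>s \<in> U\<close>, so from some index on the integrals of \<open>W\<close> against the
  laws are bounded by one constant. Hence the functions \<open>f = O(W)\<close> with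
  \<open>\<integral> f d\<mu>\<^sub>n \<longlonglongrightarrow> \<integral> f d\<nu>\<close> form a vector space closed under \<open>W\<close>-uniform approximation
  (\<open>tested_limit\<close>). By hypothesis this space contains \<open>exp (s \<bullet> x)\<close> for \<open>s\<close> near \<open>a\<close>, and it grows
  as follows.

  \<^item> Difference quotients in \<open>s\<close> give \<open>(t \<bullet> x)^k * exp (a \<bullet> x)\<close> for short vectors \<open>t\<close>
    (\<open>tested_power_exp\<close>), and the Taylor series of the exponential gives
    \<open>exp (a \<bullet> x) * exp (\<i> * (t \<bullet> x))\<close>. The expansion can be repeated after multiplication by
    \<open>exp (\<i> * (t \<bullet> x))\<close>, with the same radius, so arbitrary frequencies are reached
    (\<open>tested_rotate\<close>, \<open>tested_character\<close>). This is analytic continuation along the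
    imaginary axis.

  \<^item> A function \<open>f\<close> composed with the map that replaces each coordinate \<open>u\<close> by \<open>L * sin (u / L)\<close>
    depends only on the values of \<open>f\<close> in a cube. The Weierstrass theorem on that cube
    makes this composition a uniform limit, on the whole space, of trigonometric polynomials. As
    \<open>L\<close> grows the map tends to the identity, and \<open>exp (a \<bullet> x) * f x\<close> is reached for every bounded
    continuous \<open>f\<close> (\<open>tested_bounded_continuous\<close>).

  \<^item> A compactly supported continuous function is \<open>exp (a \<bullet> x)\<close> times a bounded continuous one, so its
    integrals converge. As all measures have mass one, no mass escapes to infinity, and
    compactly supported test functions suffice (\<open>integral_converges_if_compact_support\<close>).
\<close>

section \<open>Integrals controlled by a weight\<close>

lemma power_le_fact_exp:
  fixes y :: real
  assumes "0 \<le> y"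
  shows "y ^ k \<le> fact k * exp y"
proof -
  have "(\<Sum>n\<in>{k}. y ^ n /\<^sub>R fact n) \<le> (\<Sum>n. y ^ n /\<^sub>R fact n)"
    by (rule sum_le_suminf) (use assms summable_exp_generic[of y] in auto)
  then show ?thesis
    by (simp add: exp_def field_simps)
qed

text \<open>
  A common bound for the integrals of \<open>W\<close>, the same for all the measures, is what makes
  approximation up to \<open>\<epsilon> * W\<close> harmless for all integrals simultaneously.
\<close>

locale dominated_measures =
  fixes \<mu> :: "nat \<Rightarrow> 'a::euclidean_space measure" and \<nu> :: "'a measure"
    and W :: "'a \<Rightarrow> real" and C :: real
  assumes sets_\<mu> [measurable_cong]: "\<And>n. sets (\<mu> n) = sets borel"
    and sets_\<nu> [measurable_cong]: "sets \<nu> = sets borel"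
    and integrable_\<mu>: "\<And>n. integrable (\<mu> n) W"
    and integrable_\<nu>: "integrable \<nu> W"
    and integral_\<mu>: "\<And>n. (\<integral>x. W x \<partial>\<mu> n) \<le> C"
    and integral_\<nu>: "(\<integral>x. W x \<partial>\<nu>) \<le> C"
    and W_nonneg: "\<And>x. 0 \<le> W x"
begin

text \<open>
  The bound by a multiple of \<open>W\<close> is part of the notion because the integral of a
  non-integrable function is zero by convention, which would destroy additivity.
\<close>

definition tested :: "('a \<Rightarrow> complex) \<Rightarrow> bool" where
  "tested f \<longleftrightarrow> f \<in> borel_measurable borel \<and> (\<exists>K. \<forall>x. cmod (f x) \<le> K * W x) \<and>
     (\<lambda>n. \<integral>x. f x \<partial>\<mu> n) \<longlonglongrightarrow> (\<integral>x. f x \<partial>\<nu>)"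

lemma dominated_integrable:
  assumes "f \<in> borel_measurable borel" and "\<And>x. cmod (f x) \<le> K * W x"
  shows "integrable (\<mu> n) f" "integrable \<nu> f"
proof -
  have "f \<in> borel_measurable (\<mu> n)" "f \<in> borel_measurable \<nu>"
    using assms(1) by (auto simp: measurable_cong_sets[OF sets_\<mu> refl] measurable_cong_sets[OF sets_\<nu> refl])
  moreover have "norm (f x) \<le> norm (K * W x)" for x
    using assms(2)[of x] by simp
  ultimately show "integrable (\<mu> n) f" "integrable \<nu> f"
    using integrable_\<mu>[of n] integrable_\<nu>
    by (blast intro: Bochner_Integration.integrable_bound integrable_mult_right AE_I2)+
qed

lemma dominated_integral:
  assumes "f \<in> borel_measurable borel" and "\<And>x. cmod (f x) \<le> K * W x" and "0 \<le> K"
  shows "cmod (\<integral>x. f x \<partial>\<mu> n) \<le> K * C" "cmod (\<integral>x. f x \<partial>\<nu>) \<le> K * C"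
proof -
  have "cmod (\<integral>x. f x \<partial>\<mu> n) \<le> (\<integral>x. K * W x \<partial>\<mu> n)"
    using assms integrable_\<mu> dominated_integrable(1)[OF assms(1,2)]
    by (intro order_trans[OF integral_norm_bound] integral_mono) auto
  also have "\<dots> \<le> K * C"
    using integral_\<mu>[of n] assms(3) by (simp add: mult_left_mono)
  finally show "cmod (\<integral>x. f x \<partial>\<mu> n) \<le> K * C" .
  have "cmod (\<integral>x. f x \<partial>\<nu>) \<le> (\<integral>x. K * W x \<partial>\<nu>)"
    using assms integrable_\<nu> dominated_integrable(2)[OF assms(1,2)]
    by (intro order_trans[OF integral_norm_bound] integral_mono) auto
  also have "\<dots> \<le> K * C"
    using integral_\<nu> assms(3) by (simp add: mult_left_mono)
  finally show "cmod (\<integral>x. f x \<partial>\<nu>) \<le> K * C" .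
qed

lemma tested_add:
  assumes "tested f" "tested g"
  shows "tested (\<lambda>x. f x + g x)"
proof -
  obtain K L where K: "\<And>x. cmod (f x) \<le> K * W x" and L: "\<And>x. cmod (g x) \<le> L * W x"
    using assms unfolding tested_def by blast
  have "cmod (f x + g x) \<le> (K + L) * W x" for x
    using K[of x] L[of x] norm_triangle_ineq[of "f x" "g x"] by (simp add: algebra_simps)
  moreover have "(\<lambda>x. f x + g x) \<in> borel_measurable borel"
    using assms unfolding tested_def by auto
  moreover have "(\<lambda>n. \<integral>x. f x + g x \<partial>\<mu> n) \<longlonglongrightarrow> (\<integral>x. f x + g x \<partial>\<nu>)"
  proof -
    have f: "f \<in> borel_measurable borel" and g: "g \<in> borel_measurable borel"
      using assms unfolding tested_def by auto
    show ?thesis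
      using assms dominated_integrable[OF f K] dominated_integrable[OF g L]
      unfolding tested_def by (auto intro: tendsto_add)
  qed
  ultimately show ?thesis unfolding tested_def by blast
qed

lemma tested_scale:
  assumes "tested f"
  shows "tested (\<lambda>x. c * f x)"
proof -
  obtain K where K: "\<And>x. cmod (f x) \<le> K * W x"
    using assms unfolding tested_def by blast
  have "cmod (c * f x) \<le> (cmod c * K) * W x" for x
    using mult_left_mono[OF K[of x], of "cmod c"] by (simp add: norm_mult mult.assoc)
  moreover have "(\<lambda>x. c * f x) \<in> borel_measurable borel"
    using assms unfolding tested_def by (auto intro: borel_measurable_times)
  moreover have "(\<lambda>n. \<integral>x. c * f x \<partial>\<mu> n) \<longlonglongrightarrow> (\<integral>x. c * f x \<partial>\<nu>)"
    using assms unfolding tested_def integral_mult_right_zero by (intro tendsto_mult_left) simp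
  ultimately show ?thesis unfolding tested_def by blast
qed

lemma tested_diff:
  assumes "tested f" "tested g"
  shows "tested (\<lambda>x. f x - g x)"
  using tested_add[OF assms(1) tested_scale[OF assms(2), of "-1"]] by simp

lemma tested_zero: "tested (\<lambda>x. 0)"
  unfolding tested_def by (auto intro!: exI[of _ 0])

lemma tested_sum:
  assumes "finite I" "\<And>i. i \<in> I \<Longrightarrow> tested (f i)"
  shows "tested (\<lambda>x. \<Sum>i\<in>I. f i x)"
  using assms by (induction I) (auto intro: tested_add tested_zero)

text \<open>
  Replacing \<open>f\<close> by \<open>g\<close> changes each of the integrals by at most \<open>\<epsilon> * C\<close>, independently of \<open>n\<close>, so the
  usual three-epsilon argument applies.
\<close>

lemma tested_limit:
  assumes f [measurable]: "f \<in> borel_measurable borel"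
    and approx: "\<And>\<epsilon>. 0 < \<epsilon> \<Longrightarrow> \<exists>g. tested g \<and> (\<forall>x. cmod (f x - g x) \<le> \<epsilon> * W x)"
  shows "tested f"
proof -
  have C: "0 \<le> C"
    using Bochner_Integration.integral_nonneg[OF W_nonneg] integral_\<nu> by (rule order_trans)
  obtain g K where "tested g" and g: "\<And>x. cmod (f x - g x) \<le> 1 * W x" and K: "\<And>x. cmod (g x) \<le> K * W x"
    using approx[of 1] unfolding tested_def by auto
  have bound: "cmod (f x) \<le> (1 + K) * W x" for x
    using g[of x] K[of x] norm_triangle_ineq[of "f x - g x" "g x"] by (simp add: algebra_simps)
  have "(\<lambda>n. \<integral>x. f x \<partial>\<mu> n) \<longlonglongrightarrow> (\<integral>x. f x \<partial>\<nu>)"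
  proof (rule LIMSEQ_I)
    fix r :: real assume r: "0 < r"
    \<comment> \<open>The summand 1 guards against \<open>C = 0\<close>.\<close>
    define \<epsilon> where "\<epsilon> = r / (4 * (C + 1))"
    have \<epsilon>: "0 < \<epsilon>" "\<epsilon> * C \<le> r / 4"
      using r C by (auto simp: \<epsilon>_def field_simps)
    obtain g L where g: "tested g" and d: "\<And>x. cmod (f x - g x) \<le> \<epsilon> * W x" and L: "\<And>x. cmod (g x) \<le> L * W x"
      using approx[OF \<epsilon>(1)] unfolding tested_def by auto
    have gm [measurable]: "g \<in> borel_measurable borel" and gl: "(\<lambda>n. \<integral>x. g x \<partial>\<mu> n) \<longlonglongrightarrow> (\<integral>x. g x \<partial>\<nu>)"
      using g unfolding tested_def by auto
    note int = dominated_integrable[OF f bound] dominated_integrable[OF gm L]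
    have dm: "(\<lambda>x. f x - g x) \<in> borel_measurable borel" by simp
    note close = dominated_integral[OF dm d less_imp_le[OF \<epsilon>(1)]]
    obtain N where N: "\<And>n. N \<le> n \<Longrightarrow> cmod ((\<integral>x. g x \<partial>\<mu> n) - (\<integral>x. g x \<partial>\<nu>)) < r / 4"
      using LIMSEQ_D[OF gl, of "r/4"] r by auto
    have "cmod ((\<integral>x. f x \<partial>\<mu> n) - (\<integral>x. f x \<partial>\<nu>)) < r" if "N \<le> n" for n
    proof -
      have 1: "cmod ((\<integral>x. f x \<partial>\<mu> n) - (\<integral>x. g x \<partial>\<mu> n)) \<le> r / 4"
        "cmod ((\<integral>x. f x \<partial>\<nu>) - (\<integral>x. g x \<partial>\<nu>)) \<le> r / 4"
        using close(1)[of n] close(2) \<epsilon>(2) int(1,3)[of n] int(2,4) by auto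
      have "(\<integral>x. f x \<partial>\<mu> n) - (\<integral>x. f x \<partial>\<nu>) =
        ((\<integral>x. f x \<partial>\<mu> n) - (\<integral>x. g x \<partial>\<mu> n)) + ((\<integral>x. g x \<partial>\<mu> n) - (\<integral>x. g x \<partial>\<nu>)) - ((\<integral>x. f x \<partial>\<nu>) - (\<integral>x. g x \<partial>\<nu>))"
        by simp
      also have "cmod \<dots> \<le> r / 4 + cmod ((\<integral>x. g x \<partial>\<mu> n) - (\<integral>x. g x \<partial>\<nu>)) + r / 4"
        by (intro order_trans[OF norm_triangle_ineq4] order_trans[OF norm_triangle_ineq] add_mono 1 order_refl)
      also have "\<dots> < r" using N[OF that] r by linarith
      finally show ?thesis .
    qed
    then show "\<exists>N. \<forall>n\<ge>N. norm ((\<integral>x. f x \<partial>\<mu> n) - (\<integral>x. f x \<partial>\<nu>)) < r" by auto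
  qed
  then show ?thesis unfolding tested_def using bound f by blast
qed

end

section \<open>Continuation from real exponentials to characters\<close>

text \<open>
  The weight exceeds \<open>exp (a \<bullet> x)\<close> by a factor that absorbs every polynomial and every \<open>exp (t \<bullet> x)\<close>
  with \<open>t\<close> shorter than \<open>\<rho>\<close>.
\<close>

locale exponential_moments = dominated_measures \<mu> \<nu> "\<lambda>x. exp (a \<bullet> x + \<rho> * norm x)" C
  for \<mu> \<nu> and a :: "'a::euclidean_space" and \<rho> C +
  assumes \<rho>: "0 < \<rho>"
    and mgf_converges: "\<And>s. dist a s < \<rho> \<Longrightarrow>
      (\<lambda>n. \<integral>x. exp (s \<bullet> x) \<partial>\<mu> n) \<longlonglongrightarrow> (\<integral>x. exp (s \<bullet> x) \<partial>\<nu>)"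
begin

lemma tested_exp:
  assumes "dist a s < \<rho>"
  shows "tested (\<lambda>x. of_real (exp (s \<bullet> x)))"
proof -
  have "s \<bullet> x \<le> a \<bullet> x + \<rho> * norm x" for x
  proof -
    have "(s - a) \<bullet> x \<le> norm (s - a) * norm x" by (rule norm_cauchy_schwarz)
    also have "\<dots> \<le> \<rho> * norm x"
      using assms by (intro mult_right_mono) (auto simp: dist_norm norm_minus_commute)
    finally show ?thesis by (simp add: inner_diff_left)
  qed
  then show ?thesis
    unfolding tested_def using tendsto_of_real[OF mgf_converges[OF assms], where 'a = complex]
    by (auto intro!: exI[of _ 1] simp: integral_complex_of_real)
qed

text \<open>
  The factor 3 leaves room for three exponentials of \<open>\<bar>t \<bullet> x\<bar>\<close>: the estimates below spend them on
  powers of \<open>t \<bullet> x\<close> and on remainders of Taylor expansions.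
\<close>

lemma weight_absorbs:
  assumes "3 * norm t \<le> \<rho>"
  shows "exp (a \<bullet> x) * exp (3 * \<bar>t \<bullet> x\<bar>) \<le> exp (a \<bullet> x + \<rho> * norm x)"
proof -
  have "3 * \<bar>t \<bullet> x\<bar> \<le> 3 * (norm t * norm x)" using Cauchy_Schwarz_ineq2[of t x] by simp
  also have "\<dots> \<le> \<rho> * norm x" using mult_right_mono[OF assms, of "norm x"] by simp
  finally show ?thesis by (simp add: exp_add)
qed

text \<open>
  The step from \<open>k\<close> to \<open>k + 1\<close> is differentiation with respect to \<open>\<sigma>\<close>: the difference quotients lie in
  the space by the induction hypothesis and converge to the derivative at a rate proportional
  to \<open>\<delta> * W\<close>. The parameter \<open>\<sigma>\<close> has to be kept general for this to be an induction.
\<close>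

lemma tested_power_exp:
  assumes t: "3 * norm t \<le> \<rho>" and "\<bar>\<sigma>\<bar> < 1"
  shows "tested (\<lambda>x. of_real ((t \<bullet> x) ^ k * exp ((a + \<sigma> *\<^sub>R t) \<bullet> x)))"
  using assms(2)
proof (induction k arbitrary: \<sigma>)
  case 0
  have "norm (\<sigma> *\<^sub>R t) < \<rho>"
  proof -
    have "\<bar>\<sigma>\<bar> * norm t \<le> 1 * norm t" using 0 by (intro mult_right_mono) auto
    then show ?thesis using t \<rho> norm_ge_zero[of t] by (simp del: norm_ge_zero)
  qed
  then show ?case using tested_exp[of "a + \<sigma> *\<^sub>R t"] by (simp add: dist_norm)
next
  case (Suc k)
  show ?case
  proof (rule tested_limit)
    fix \<epsilon> :: real assume \<epsilon>: "0 < \<epsilon>"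
    \<comment> \<open>The first bound keeps \<open>\<sigma> + \<delta>\<close> admissible; the second compensates the constant in
      \<open>power_le_fact_exp\<close> for the power \<open>k + 2\<close>, in which two factors come from the Taylor remainder.\<close>
    define \<delta> where "\<delta> = min ((1 - \<bar>\<sigma>\<bar>) / 2) (\<epsilon> / fact (k + 2))"
    have \<delta>: "0 < \<delta>" "\<bar>\<sigma>\<bar> + \<delta> < 1" "\<bar>\<sigma> + \<delta>\<bar> < 1" "\<delta> * fact (k + 2) \<le> \<epsilon>"
    proof -
      show "0 < \<delta>" using \<epsilon> Suc.prems by (simp add: \<delta>_def)
      have "\<delta> \<le> (1 - \<bar>\<sigma>\<bar>) / 2" unfolding \<delta>_def by (rule min.cobounded1)
      then show 1: "\<bar>\<sigma>\<bar> + \<delta> < 1" using Suc.prems by argo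
      then show "\<bar>\<sigma> + \<delta>\<bar> < 1" using \<open>0 < \<delta>\<close> by linarith
      have "\<delta> \<le> \<epsilon> / fact (k + 2)" unfolding \<delta>_def by (rule min.cobounded2)
      then show "\<delta> * fact (k + 2) \<le> \<epsilon>" by (simp only: pos_le_divide_eq[OF fact_gt_zero])
    qed
    define g where "g x = of_real (1 / \<delta>) * (of_real ((t \<bullet> x) ^ k * exp ((a + (\<sigma> + \<delta>) *\<^sub>R t) \<bullet> x))
       - of_real ((t \<bullet> x) ^ k * exp ((a + \<sigma> *\<^sub>R t) \<bullet> x)) :: complex)" for x
    have "tested g"
      unfolding g_def by (intro tested_scale tested_diff Suc.IH \<delta> Suc.prems)
    moreover have "cmod (of_real ((t \<bullet> x) ^ Suc k * exp ((a + \<sigma> *\<^sub>R t) \<bullet> x)) - g x)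
        \<le> \<epsilon> * exp (a \<bullet> x + \<rho> * norm x)" for x
    proof -
      define y where "y = t \<bullet> x"
      have g_eq: "g x = of_real (y ^ k * exp (a \<bullet> x + \<sigma> * y) * ((exp (\<delta> * y) - 1) / \<delta>))"
        using \<delta>(1) by (simp add: g_def y_def inner_add_left exp_add field_simps)
      have tay: "\<bar>exp (\<delta> * y) - (1 + \<delta> * y)\<bar> \<le> exp \<bar>\<delta> * y\<bar> * (\<delta> * y)\<^sup>2"
        using Taylor_exp_field[of "\<delta> * y" 1] by (simp add: power2_eq_square abs_mult)
      have "\<bar>y - (exp (\<delta> * y) - 1) / \<delta>\<bar> = \<bar>exp (\<delta> * y) - (1 + \<delta> * y)\<bar> / \<delta>"
      proof -
        have "y - (exp (\<delta> * y) - 1) / \<delta> = - ((exp (\<delta> * y) - (1 + \<delta> * y)) / \<delta>)"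
          using \<delta>(1) by (simp add: field_simps)
        then show ?thesis using \<delta>(1) by (simp only: abs_minus_cancel abs_divide abs_of_pos)
      qed
      also have "\<dots> \<le> \<delta> * \<bar>y\<bar>\<^sup>2 * exp (\<delta> * \<bar>y\<bar>)"
        using tay \<delta>(1) by (simp add: field_simps power2_eq_square abs_mult)
      finally have diff: "\<bar>y - (exp (\<delta> * y) - 1) / \<delta>\<bar> \<le> \<delta> * \<bar>y\<bar>\<^sup>2 * exp (\<delta> * \<bar>y\<bar>)" .
      have exps: "exp (\<sigma> * y) * exp (\<delta> * \<bar>y\<bar>) \<le> exp \<bar>y\<bar>"
      proof -
        have "\<sigma> * y + \<delta> * \<bar>y\<bar> \<le> \<bar>\<sigma>\<bar> * \<bar>y\<bar> + \<delta> * \<bar>y\<bar>"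
          by (metis abs_ge_self abs_mult add_right_mono)
        also have "\<dots> \<le> 1 * \<bar>y\<bar>"
          unfolding distrib_right[symmetric] using \<delta>(2) by (intro mult_right_mono) auto
        finally show ?thesis by (simp add: exp_add[symmetric])
      qed
      have "cmod (of_real ((t \<bullet> x) ^ Suc k * exp ((a + \<sigma> *\<^sub>R t) \<bullet> x)) - g x)
         = cmod (of_real (y ^ k * exp (a \<bullet> x + \<sigma> * y) * (y - (exp (\<delta> * y) - 1) / \<delta>)))"
        unfolding g_eq by (simp add: y_def inner_add_left algebra_simps)
      also have "\<dots> = \<bar>y\<bar> ^ k * exp (a \<bullet> x) * exp (\<sigma> * y) * \<bar>y - (exp (\<delta> * y) - 1) / \<delta>\<bar>"
        by (simp only: norm_of_real abs_mult power_abs exp_add abs_exp_cancel mult.assoc)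
      also have "\<dots> \<le> \<bar>y\<bar> ^ k * exp (a \<bullet> x) * exp (\<sigma> * y) * (\<delta> * \<bar>y\<bar>\<^sup>2 * exp (\<delta> * \<bar>y\<bar>))"
        by (intro mult_left_mono diff) auto
      also have "\<dots> = \<delta> * exp (a \<bullet> x) * \<bar>y\<bar> ^ (k + 2) * (exp (\<sigma> * y) * exp (\<delta> * \<bar>y\<bar>))"
        by (simp add: power_add power2_eq_square algebra_simps)
      also have "\<dots> \<le> \<delta> * exp (a \<bullet> x) * (fact (k + 2) * exp \<bar>y\<bar>) * exp \<bar>y\<bar>"
        using \<delta>(1) exps power_le_fact_exp[of "\<bar>y\<bar>" "k + 2"] by (intro mult_mono mult_left_mono) auto
      also have "\<dots> = (\<delta> * fact (k + 2)) * (exp (a \<bullet> x) * exp (2 * \<bar>y\<bar>))"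
        by (simp add: mult_exp_exp algebra_simps)
      also have "\<dots> \<le> \<epsilon> * (exp (a \<bullet> x) * exp (3 * \<bar>y\<bar>))"
        using \<delta>(4) \<epsilon> by (intro mult_mono) auto
      also have "\<dots> \<le> \<epsilon> * exp (a \<bullet> x + \<rho> * norm x)"
        using \<epsilon> weight_absorbs[OF t, of x] by (simp add: y_def)
      finally show ?thesis .
    qed
    ultimately show "\<exists>g. tested g \<and> (\<forall>x. cmod (of_real ((t \<bullet> x) ^ Suc k * exp ((a + \<sigma> *\<^sub>R t) \<bullet> x)) - g x)
        \<le> \<epsilon> * exp (a \<bullet> x + \<rho> * norm x))" by blast
  qed simp
qed

text \<open>
  Expanding \<open>iexp (t \<bullet> x)\<close> in its Taylor series turns the claim into the hypothesis for the powers
  \<open>k + j\<close>. Since \<open>h\<close> is bounded by one, the error estimate is the same for every \<open>h\<close>; in particular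
  the admissible length of \<open>t\<close> does not shrink when the lemma is iterated.
\<close>

lemma tested_rotate:
  assumes t: "3 * norm t \<le> \<rho>"
    and h [measurable]: "h \<in> borel_measurable borel" and h1: "\<And>x. cmod (h x) \<le> 1"
    and IH: "\<And>k. tested (\<lambda>x. of_real ((t \<bullet> x) ^ k * exp (a \<bullet> x)) * h x)"
  shows "tested (\<lambda>x. of_real ((t \<bullet> x) ^ k * exp (a \<bullet> x)) * (h x * iexp (t \<bullet> x)))"
proof (rule tested_limit)
  fix \<epsilon> :: real assume \<epsilon>: "0 < \<epsilon>"
  \<comment> \<open>The remainder beyond degree \<open>J\<close> is at most \<open>(1/2)^J * exp (2 * \<bar>t \<bullet> x\<bar>)\<close>, and the
    factor \<open>(t \<bullet> x)^k\<close> costs \<open>fact k\<close> and one more exponential.\<close>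
  obtain J where J: "(1/2) ^ J < \<epsilon> / fact k"
    using real_arch_pow_inv[of "\<epsilon> / fact k" "1/2"] \<epsilon> by auto
  define g where "g x = (\<Sum>j\<le>J. (\<i> ^ j / fact j) * (of_real ((t \<bullet> x) ^ (k + j) * exp (a \<bullet> x)) * h x))" for x
  have "tested g"
    unfolding g_def by (intro tested_sum tested_scale IH) auto
  moreover have "cmod (of_real ((t \<bullet> x) ^ k * exp (a \<bullet> x)) * (h x * iexp (t \<bullet> x)) - g x)
      \<le> \<epsilon> * exp (a \<bullet> x + \<rho> * norm x)" for x
  proof -
    define y where "y = t \<bullet> x"
    define T where "T = iexp y - (\<Sum>j\<le>J. (\<i> * y) ^ j / fact j)"
    have "g x = of_real (y ^ k * exp (a \<bullet> x)) * h x * (\<Sum>j\<le>J. (\<i> * y) ^ j / fact j)"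
      unfolding g_def sum_distrib_left y_def
      by (intro sum.cong refl) (simp add: power_add power_mult_distrib field_simps)
    then have "of_real ((t \<bullet> x) ^ k * exp (a \<bullet> x)) * (h x * iexp (t \<bullet> x)) - g x
        = of_real (y ^ k * exp (a \<bullet> x)) * h x * T"
      unfolding T_def y_def by (simp add: algebra_simps)
    then have "cmod (of_real ((t \<bullet> x) ^ k * exp (a \<bullet> x)) * (h x * iexp (t \<bullet> x)) - g x)
        = \<bar>y\<bar> ^ k * exp (a \<bullet> x) * cmod (h x) * cmod T"
      by (simp add: norm_mult norm_power)
    also have "\<dots> \<le> \<bar>y\<bar> ^ k * exp (a \<bullet> x) * 1 * ((1/2) ^ J * exp (2 * \<bar>y\<bar>))"
    proof -
      have "cmod T \<le> \<bar>y\<bar> ^ Suc J / fact (Suc J)"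
        unfolding T_def using iexp_approx1[of y J] by simp
      also have "\<dots> = (1/2) ^ Suc J * ((2 * \<bar>y\<bar>) ^ Suc J / fact (Suc J))"
        by (simp only: power_mult_distrib) (simp add: field_simps)
      also have "\<dots> \<le> (1/2) ^ Suc J * exp (2 * \<bar>y\<bar>)"
        using power_le_fact_exp[of "2 * \<bar>y\<bar>" "Suc J"]
        by (intro mult_left_mono) (simp_all only: pos_divide_le_eq[OF fact_gt_zero] mult.commute, simp_all)
      also have "\<dots> \<le> (1/2) ^ J * exp (2 * \<bar>y\<bar>)" by simp
      finally show ?thesis using h1[of x] by (intro mult_mono mult_left_mono) auto
    qed
    also have "\<dots> \<le> (fact k * exp \<bar>y\<bar>) * exp (a \<bullet> x) * 1 * ((1/2) ^ J * exp (2 * \<bar>y\<bar>))"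
      using power_le_fact_exp[of "\<bar>y\<bar>" k] by (intro mult_right_mono) auto
    also have "\<dots> = (fact k * (1/2) ^ J) * (exp (a \<bullet> x) * exp (3 * \<bar>y\<bar>))"
      by (simp add: mult_exp_exp algebra_simps)
    also have "\<dots> \<le> \<epsilon> * exp (a \<bullet> x + \<rho> * norm x)"
      using J \<epsilon> weight_absorbs[OF t, of x] unfolding y_def
      by (intro mult_mono) (auto simp: field_simps)
    finally show ?thesis .
  qed
  ultimately show "\<exists>g. tested g \<and> (\<forall>x. cmod (of_real ((t \<bullet> x) ^ k * exp (a \<bullet> x)) * (h x * iexp (t \<bullet> x)) - g x)
      \<le> \<epsilon> * exp (a \<bullet> x + \<rho> * norm x))" by blast
qed simp

text \<open>
  An arbitrary frequency \<open>t\<close> is reached in \<open>m\<close> short steps \<open>u = t / m\<close>.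
\<close>

lemma tested_character:
  "tested (\<lambda>x. of_real (exp (a \<bullet> x)) * iexp (t \<bullet> x))"
proof -
  obtain m :: nat where m: "3 * norm t / \<rho> < real m"
    using reals_Archimedean2 by blast
  have m0: "0 < real m" using m \<rho> by (smt (verit) divide_nonneg_pos norm_ge_zero)
  define u where "u = t /\<^sub>R real m"
  have u: "3 * norm u \<le> \<rho>"
    using m m0 \<rho> by (simp add: u_def field_simps)
  have 1: "tested (\<lambda>x. of_real ((u \<bullet> x) ^ k * exp (a \<bullet> x)) * iexp (real j * (u \<bullet> x)))" for j k
  proof (induction j arbitrary: k)
    case 0
    show ?case using tested_power_exp[OF u, of 0 k] by simp
  next
    case (Suc j)
    have "tested (\<lambda>x. of_real ((u \<bullet> x) ^ k * exp (a \<bullet> x)) * (iexp (real j * (u \<bullet> x)) * iexp (u \<bullet> x)))"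
      by (rule tested_rotate[OF u _ _ Suc.IH]) auto
    then show ?case by (simp add: exp_add[symmetric] algebra_simps)
  qed
  have "real m * (u \<bullet> x) = t \<bullet> x" for x
    using m0 by (simp add: u_def)
  then show ?thesis using 1[of 0 m] by (simp only: power_0 mult_1)
qed

end

section \<open>Trigonometric polynomials and the sine map\<close>

inductive trig_poly :: "('a::real_inner \<Rightarrow> complex) \<Rightarrow> bool" where
  character: "trig_poly (\<lambda>x. c * iexp (t \<bullet> x))"
| add: "trig_poly f \<Longrightarrow> trig_poly g \<Longrightarrow> trig_poly (\<lambda>x. f x + g x)"

lemma trig_poly_const: "trig_poly (\<lambda>x. c)"
  using trig_poly.character[of c 0] by simp

lemma trig_poly_sum:
  assumes "finite I" "\<And>i. i \<in> I \<Longrightarrow> trig_poly (f i)"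
  shows "trig_poly (\<lambda>x. \<Sum>i\<in>I. f i x)"
  using assms by (induction I) (auto intro: trig_poly.add trig_poly_const)

lemma trig_poly_mult:
  assumes "trig_poly f" "trig_poly g"
  shows "trig_poly (\<lambda>x. f x * g x)"
  using assms
proof (induction f rule: trig_poly.induct)
  case (character c t)
  from \<open>trig_poly g\<close> show ?case
  proof (induction g rule: trig_poly.induct)
    case (character d s)
    show ?case
      using trig_poly.character[of "c * d" "t + s"]
      by (simp add: inner_add_left distrib_left exp_add mult_ac)
  next
    case (add g h)
    then show ?case using trig_poly.add by (simp add: distrib_left)
  qed
next
  case (add f h)
  then show ?case using trig_poly.add by (simp add: distrib_right)
qed

lemma trig_poly_sin: "trig_poly (\<lambda>x. of_real (sin (t \<bullet> x)))"
proof -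
  have "of_real (sin y) = 1 / (2 * \<i>) * iexp y + - 1 / (2 * \<i>) * iexp (- y)" for y :: real
    by (simp add: sin_of_real[symmetric] sin_exp_eq field_simps)
  then show ?thesis
    using trig_poly.add[OF trig_poly.character[of "1 / (2 * \<i>)" t] trig_poly.character[of "- 1 / (2 * \<i>)" "- t"]]
    by simp
qed

text \<open>
  A smooth bounded substitute for the identity whose coordinates are trigonometric polynomials.
  Composition with it makes every continuous function bounded and turns polynomials into
  trigonometric polynomials.
\<close>

definition sine_map :: "real \<Rightarrow> 'a::euclidean_space \<Rightarrow> 'a" where
  "sine_map L x = (\<Sum>b\<in>Basis. (L * sin (x \<bullet> b / L)) *\<^sub>R b)"

lemma sine_map_inner: "b \<in> Basis \<Longrightarrow> sine_map L x \<bullet> b = L * sin (x \<bullet> b / L)"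
  by (simp add: sine_map_def)

lemma continuous_sine_map: "continuous_on UNIV (sine_map L)"
  unfolding sine_map_def divide_inverse by (intro continuous_intros)

lemma trig_poly_polynomial_sine_map:
  assumes "real_polynomial_function p"
  shows "trig_poly (\<lambda>x. of_real (p (sine_map L x)))"
  using assms
proof (induction p rule: real_polynomial_function.induct)
  case (linear f)
  interpret bounded_linear f by fact
  have "of_real (f (sine_map L x)) =
      (\<Sum>b\<in>Basis. of_real (L * f b) * of_real (sin ((b /\<^sub>R L) \<bullet> x)) :: complex)" for x
    unfolding sine_map_def sum of_real_sum scaleR
    by (intro sum.cong refl) (simp add: inner_commute divide_inverse mult_ac)
  then show ?case
    by (simp only:) (intro trig_poly_sum trig_poly_mult trig_poly_const trig_poly_sin finite_Basis)
next
  case (add f g)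
  then show ?case using trig_poly.add by simp
next
  case (mult f g)
  then show ?case using trig_poly_mult by simp
qed (rule trig_poly_const)

lemma sine_map_in_cube:
  assumes "0 < L"
  shows "sine_map L x \<in> cbox (- L *\<^sub>R One) (L *\<^sub>R One)"
proof -
  have "\<bar>L * sin y\<bar> \<le> L" for y
    using mult_left_mono[OF abs_sin_le_one[of y], of L] assms by (simp add: abs_mult)
  then have "- L \<le> L * sin y \<and> L * sin y \<le> L" for y
    using abs_le_iff[of "L * sin y" L] by auto
  then show ?thesis by (simp add: mem_box sine_map_inner)
qed

text \<open>
  In each coordinate this is \<open>\<bar>sin v - v\<bar> \<le> v\<^sup>2 / 2\<close> at \<open>v = (x \<bullet> b) / L\<close>, multiplied by \<open>L\<close>.
\<close>

lemma sine_map_close: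
  fixes x :: "'a::euclidean_space" and R :: real
  assumes "0 < L" and "norm x \<le> R"
  shows "norm (x - sine_map L x) \<le> DIM('a) * R\<^sup>2 / (2 * L)"
proof -
  have "norm (x - sine_map L x) \<le> (\<Sum>b\<in>Basis. \<bar>(x - sine_map L x) \<bullet> b\<bar>)"
    by (rule norm_le_l1)
  also have "\<dots> \<le> (\<Sum>b\<in>(Basis :: 'a set). R\<^sup>2 / (2 * L))"
  proof (rule sum_mono)
    fix b :: 'a assume b: "b \<in> Basis"
    define y where "y = x \<bullet> b"
    have y: "y\<^sup>2 \<le> R\<^sup>2"
      using Basis_le_norm[OF b, of x] assms(2) unfolding y_def by (intro abs_le_square_iff[THEN iffD1]) auto
    \<comment> \<open>Imaginary part of the first-order expansion of \<open>iexp\<close>.\<close>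
    have "\<bar>sin v - v\<bar> \<le> v\<^sup>2 / 2" for v :: real
      using order_trans[OF abs_Im_le_cmod iexp_approx1[of v 1]]
      by (simp add: Im_exp power2_eq_square abs_mult)
    then have "L * \<bar>sin (y / L) - y / L\<bar> \<le> L * ((y / L)\<^sup>2 / 2)"
      using assms(1) by (intro mult_left_mono) auto
    also have "\<dots> = y\<^sup>2 / (2 * L)" using assms(1) by (simp add: power2_eq_square)
    also have "\<dots> \<le> R\<^sup>2 / (2 * L)" using y assms(1) by (intro divide_right_mono) auto
    also have "L * \<bar>sin (y / L) - y / L\<bar> = \<bar>L * (sin (y / L) - y / L)\<bar>"
      using assms(1) by (simp only: abs_mult)
    also have "L * (sin (y / L) - y / L) = - (y - L * sin (y / L))"
      using assms(1) by (simp add: algebra_simps)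
    finally show "\<bar>(x - sine_map L x) \<bullet> b\<bar> \<le> R\<^sup>2 / (2 * L)"
      by (simp add: inner_diff_left sine_map_inner[OF b] y_def)
  qed
  finally show ?thesis by simp
qed

section \<open>Tilted bounded continuous functions\<close>

context exponential_moments
begin

lemma tested_trig_poly:
  assumes "trig_poly f"
  shows "tested (\<lambda>x. of_real (exp (a \<bullet> x)) * f x)"
  using assms
proof (induction f rule: trig_poly.induct)
  case (character c t)
  show ?case using tested_scale[OF tested_character, of c t] by (simp add: mult_ac)
next
  case (add f g)
  then show ?case using tested_add by (simp add: distrib_left)
qed

text \<open>
  The sine map takes values in a compact cube, so an approximation of \<open>f\<close> by a polynomial on that cube
  becomes, after composition, uniform on the whole space.
\<close>

lemma tested_sine_map:
  assumes f: "continuous_on UNIV f" and L: "0 < L"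
  shows "tested (\<lambda>x. of_real (exp (a \<bullet> x) * f (sine_map L x)))"
proof (rule tested_limit)
  have "continuous_on UNIV (\<lambda>x. f (sine_map L x))"
    by (rule continuous_on_compose2[OF f continuous_sine_map]) simp
  then show "(\<lambda>x. complex_of_real (exp (a \<bullet> x) * f (sine_map L x))) \<in> borel_measurable borel"
    by (intro borel_measurable_continuous_onI continuous_intros)
next
  fix \<epsilon> :: real assume \<epsilon>: "0 < \<epsilon>"
  obtain p where p: "real_polynomial_function p"
    and close: "\<And>x. x \<in> cbox (- L *\<^sub>R One) (L *\<^sub>R One) \<Longrightarrow> \<bar>f x - p x\<bar> < \<epsilon>"
    using Stone_Weierstrass_real_polynomial_function[OF compact_cbox continuous_on_subset[OF f] \<epsilon>] by blast
  define g where "g x = of_real (exp (a \<bullet> x)) * complex_of_real (p (sine_map L x))" for x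
  have "tested g"
    unfolding g_def by (intro tested_trig_poly trig_poly_polynomial_sine_map p)
  moreover have "cmod (of_real (exp (a \<bullet> x) * f (sine_map L x)) - g x) \<le> \<epsilon> * exp (a \<bullet> x + \<rho> * norm x)" for x
  proof -
    have "cmod (of_real (exp (a \<bullet> x) * f (sine_map L x)) - g x)
        = cmod (of_real (exp (a \<bullet> x) * (f (sine_map L x) - p (sine_map L x))))"
      by (simp add: g_def algebra_simps)
    also have "\<dots> = exp (a \<bullet> x) * \<bar>f (sine_map L x) - p (sine_map L x)\<bar>"
      by (simp only: norm_of_real abs_mult abs_exp_cancel)
    also have "\<dots> \<le> exp (a \<bullet> x + \<rho> * norm x) * \<epsilon>"
      using close[OF sine_map_in_cube[OF L, of x]] \<rho> by (intro mult_mono) auto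
    finally show ?thesis by (simp add: mult.commute)
  qed
  ultimately show "\<exists>g. tested g \<and> (\<forall>x. cmod (of_real (exp (a \<bullet> x) * f (sine_map L x)) - g x)
      \<le> \<epsilon> * exp (a \<bullet> x + \<rho> * norm x))" by blast
qed

text \<open>
  The functions \<open>f (sine_map L x)\<close> are uniformly close to \<open>f x\<close> only on bounded sets, but far
  from the origin the factor \<open>exp (\<rho> * norm x)\<close> outgrows the bound \<open>2 * B\<close> for the
  difference.
\<close>

lemma tested_bounded_continuous:
  fixes f :: "'a \<Rightarrow> real"
  assumes f: "continuous_on UNIV f" and B: "\<And>x. \<bar>f x\<bar> \<le> B"
  shows "tested (\<lambda>x. of_real (exp (a \<bullet> x) * f x))"
proof (rule tested_limit)
  show "(\<lambda>x. complex_of_real (exp (a \<bullet> x) * f x)) \<in> borel_measurable borel"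
    using f by (intro borel_measurable_continuous_onI continuous_intros)
next
  fix \<epsilon> :: real assume \<epsilon>: "0 < \<epsilon>"
  \<comment> \<open>By \<open>exp u \<ge> u\<close>, the weight beats \<open>2 * B\<close> beyond this radius; the absolute value makes
    \<open>R\<close> nonnegative.\<close>
  define R where "R = \<bar>2 * B / (\<epsilon> * \<rho>)\<bar>"
  have far: "2 * B \<le> \<epsilon> * exp (\<rho> * norm x)" if "R < norm x" for x :: 'a
  proof -
    have "2 * B / (\<epsilon> * \<rho>) \<le> R" unfolding R_def by (rule abs_ge_self)
    then have "2 * B / (\<epsilon> * \<rho>) \<le> norm x" using that by linarith
    then have "2 * B \<le> \<epsilon> * (\<rho> * norm x)" using \<epsilon> \<rho> by (simp add: pos_divide_le_eq mult_ac)
    also have "\<dots> \<le> \<epsilon> * exp (\<rho> * norm x)"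
      using \<epsilon> exp_ge_add_one_self[of "\<rho> * norm x"] by (intro mult_left_mono) linarith+
    finally show ?thesis .
  qed
  have "uniformly_continuous_on (cball 0 (R + 1)) f"
    using f by (intro compact_uniformly_continuous) (auto intro: continuous_on_subset)
  then obtain \<delta> where \<delta>: "0 < \<delta>"
    and uc: "\<And>x y. \<lbrakk>norm x \<le> R + 1; norm y \<le> R + 1; dist y x < \<delta>\<rbrakk> \<Longrightarrow> dist (f y) (f x) < \<epsilon>"
    using \<epsilon> unfolding uniformly_continuous_on_def by (auto simp: dist_commute)
  define \<eta> where "\<eta> = min 1 (\<delta> / 2)"
  have \<eta>: "0 < \<eta>" "\<eta> \<le> 1" "\<eta> < \<delta>" using \<delta> by (auto simp: \<eta>_def)
  \<comment> \<open>Chosen so that \<open>sine_map_close\<close> gives an error of at most \<open>\<eta>\<close> on the ball of radius \<open>R\<close>; the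
    summand 1 keeps \<open>L\<close> positive when \<open>R = 0\<close>.\<close>
  define L where "L = (DIM('a) * R\<^sup>2 + 1) / (2 * \<eta>)"
  have L: "0 < L" using \<eta> by (simp add: L_def add_nonneg_pos)
  have near: "\<bar>f x - f (sine_map L x)\<bar> \<le> \<epsilon>" if x: "norm x \<le> R" for x
  proof -
    have "DIM('a) * R\<^sup>2 / (2 * L) \<le> \<eta>"
      using L \<eta> by (simp add: pos_divide_le_eq) (simp add: L_def)
    then have d: "norm (x - sine_map L x) \<le> \<eta>"
      using sine_map_close[OF L x] by linarith
    have "norm (sine_map L x) \<le> R + 1"
      using d x \<eta>(2) norm_triangle_ineq2[of "sine_map L x" x] by (simp add: norm_minus_commute)
    then show ?thesis
      using uc[of "sine_map L x" x] d x \<eta>(3) by (auto simp: dist_norm)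
  qed
  have "cmod (of_real (exp (a \<bullet> x) * f x) - of_real (exp (a \<bullet> x) * f (sine_map L x)))
      \<le> \<epsilon> * exp (a \<bullet> x + \<rho> * norm x)" for x
  proof -
    have "\<bar>f x - f (sine_map L x)\<bar> \<le> \<epsilon> * exp (\<rho> * norm x)"
    proof (cases "norm x \<le> R")
      case True
      have "\<epsilon> * 1 \<le> \<epsilon> * exp (\<rho> * norm x)" using \<epsilon> \<rho> by (intro mult_left_mono) auto
      then show ?thesis using near[OF True] by linarith
    next
      case False
      then show ?thesis using far[of x] B[of x] B[of "sine_map L x"] by linarith
    qed
    then have "exp (a \<bullet> x) * \<bar>f x - f (sine_map L x)\<bar> \<le> \<epsilon> * exp (a \<bullet> x + \<rho> * norm x)"
      by (simp add: exp_add mult.left_commute[of "exp (a \<bullet> x)"])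
    moreover have "cmod (of_real (exp (a \<bullet> x) * f x) - of_real (exp (a \<bullet> x) * f (sine_map L x)))
        = exp (a \<bullet> x) * \<bar>f x - f (sine_map L x)\<bar>"
      by (simp only: of_real_diff[symmetric] right_diff_distrib[symmetric] norm_of_real abs_mult abs_exp_cancel)
    ultimately show ?thesis by simp
  qed
  then show "\<exists>g. tested g \<and> (\<forall>x. cmod (of_real (exp (a \<bullet> x) * f x) - g x)
      \<le> \<epsilon> * exp (a \<bullet> x + \<rho> * norm x))"
    using tested_sine_map[OF f L] by blast
qed

lemma integral_converges_if_tilt_bounded:
  fixes f :: "'a \<Rightarrow> real"
  assumes f: "continuous_on UNIV f" and B: "\<And>x. \<bar>f x\<bar> \<le> B * exp (a \<bullet> x)"
  shows "(\<lambda>n. \<integral>x. f x \<partial>\<mu> n) \<longlonglongrightarrow> (\<integral>x. f x \<partial>\<nu>)"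
proof -
  have "continuous_on UNIV (\<lambda>x. exp (- (a \<bullet> x)) * f x)"
    using f by (intro continuous_intros)
  moreover have "\<bar>exp (- (a \<bullet> x)) * f x\<bar> \<le> B" for x
    using B[of x] by (simp add: abs_mult exp_minus field_simps)
  ultimately have "tested (\<lambda>x. of_real (exp (a \<bullet> x) * (exp (- (a \<bullet> x)) * f x)))"
    by (rule tested_bounded_continuous)
  also have "(\<lambda>x. exp (a \<bullet> x) * (exp (- (a \<bullet> x)) * f x)) = f"
    by (simp add: mult.assoc[symmetric] mult_exp_exp)
  finally show ?thesis
    unfolding tested_def integral_complex_of_real by (simp add: tendsto_of_real_iff)
qed

end

section \<open>From compactly supported to bounded continuous test functions\<close>

text \<open>
  Vague convergence to a probability measure is weak convergence. A continuous cutoff \<open>\<kappa> k\<close> carries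
  almost all the mass of \<open>\<nu>\<close>, hence, its integrals being convergent, almost all the mass of \<open>\<mu> n\<close>
  for large \<open>n\<close>; what \<open>f\<close> contributes outside the cutoff is then negligible for all these measures.
\<close>

lemma integral_converges_if_compact_support:
  fixes \<mu> :: "nat \<Rightarrow> 'a::euclidean_space measure"
  assumes \<mu>: "\<And>n. prob_space (\<mu> n)" "\<And>n. sets (\<mu> n) = sets borel"
    and \<nu>: "prob_space \<nu>" "sets \<nu> = sets borel"
    and compact: "\<And>f :: 'a \<Rightarrow> real. \<lbrakk>continuous_on UNIV f; \<exists>R. \<forall>x. R \<le> norm x \<longrightarrow> f x = 0\<rbrakk> \<Longrightarrow>
      (\<lambda>n. \<integral>x. f x \<partial>\<mu> n) \<longlonglongrightarrow> (\<integral>x. f x \<partial>\<nu>)"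
    and f: "continuous_on UNIV f" and bdd: "bounded (range f)"
  shows "(\<lambda>n. \<integral>x. f x \<partial>\<mu> n) \<longlonglongrightarrow> (\<integral>x. f x \<partial>\<nu> :: real)"
proof (rule LIMSEQ_I)
  fix r :: real assume r: "0 < r"
  interpret \<nu>: prob_space \<nu> by fact
  note [measurable_cong] = \<mu>(2) \<nu>(2)
  obtain B where B: "0 < B" "\<And>x. \<bar>f x\<bar> \<le> B"
    using bdd unfolding bounded_pos by auto
  define \<kappa> :: "nat \<Rightarrow> 'a \<Rightarrow> real" where "\<kappa> k x = max 0 (min 1 (real k + 1 - norm x))" for k x
  have \<kappa>: "continuous_on UNIV (\<kappa> k)" "0 \<le> \<kappa> k x" "\<kappa> k x \<le> 1" "real k + 1 \<le> norm x \<Longrightarrow> \<kappa> k x = 0" for k x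
    unfolding \<kappa>_def by (auto intro!: continuous_intros)
  have [measurable]: "\<kappa> k \<in> borel_measurable borel" "f \<in> borel_measurable borel" for k
    using \<kappa>(1) f by (auto intro: borel_measurable_continuous_onI)
  have "(\<lambda>k. \<integral>x. \<kappa> k x \<partial>\<nu>) \<longlonglongrightarrow> (\<integral>x. 1 \<partial>\<nu>)"
  proof (rule integral_dominated_convergence[where w = "\<lambda>_. 1"])
    show "AE x in \<nu>. (\<lambda>k. \<kappa> k x) \<longlonglongrightarrow> 1"
    proof (rule AE_I2)
      fix x :: 'a
      obtain k :: nat where "norm x < k" using reals_Archimedean2 by blast
      then have "eventually (\<lambda>j. \<kappa> j x = 1) sequentially"
        unfolding eventually_sequentially \<kappa>_def by (intro exI[of _ k]) auto
      then show "(\<lambda>k. \<kappa> k x) \<longlonglongrightarrow> 1" by (rule tendsto_eventually)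
    qed
  qed (use \<kappa>(2,3) in \<open>auto simp: abs_le_iff intro: order_trans[of _ 0]\<close>)
  then have "eventually (\<lambda>k. 1 - r / (8 * B) < (\<integral>x. \<kappa> k x \<partial>\<nu>)) sequentially"
    using r B(1) by (intro order_tendstoD) (auto simp: \<nu>.prob_space)
  then obtain k where k: "1 - (\<integral>x. \<kappa> k x \<partial>\<nu>) < r / (8 * B)"
    unfolding eventually_sequentially by (auto simp: algebra_simps)
  have cut: "\<bar>(\<integral>x. f x \<partial>N) - (\<integral>x. f x * \<kappa> k x \<partial>N)\<bar> \<le> B * (1 - (\<integral>x. \<kappa> k x \<partial>N))"
    if "prob_space N" and N [measurable_cong]: "sets N = sets borel" for N
  proof -
    interpret N: prob_space N by fact
    have fx: "\<bar>f x * \<kappa> k x\<bar> \<le> B" for x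
      using mult_mono[OF B(2)[of x] \<kappa>(3)[of k x]] B(1) \<kappa>(2)[of k x] by (simp add: abs_mult)
    have int: "integrable N f" "integrable N (\<lambda>x. f x * \<kappa> k x)" "integrable N (\<kappa> k)"
      using B(2) fx \<kappa>(2,3)[of k]
      by (intro N.integrable_const_bound[where B = B], simp, simp,
          intro N.integrable_const_bound[where B = B], simp, simp,
          intro N.integrable_const_bound[where B = 1], simp, simp)
    have "\<bar>(\<integral>x. f x \<partial>N) - (\<integral>x. f x * \<kappa> k x \<partial>N)\<bar> = \<bar>\<integral>x. f x - f x * \<kappa> k x \<partial>N\<bar>"
      using int by simp
    also have "\<dots> \<le> (\<integral>x. \<bar>f x - f x * \<kappa> k x\<bar> \<partial>N)"
      by (rule integral_abs_bound)
    also have "\<dots> \<le> (\<integral>x. B * (1 - \<kappa> k x) \<partial>N)"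
    proof (rule integral_mono)
      fix x
      have "\<bar>f x - f x * \<kappa> k x\<bar> = \<bar>f x\<bar> * (1 - \<kappa> k x)"
        using \<kappa>(3)[of k x] abs_mult[of "f x" "1 - \<kappa> k x"] by (simp add: right_diff_distrib)
      then show "\<bar>f x - f x * \<kappa> k x\<bar> \<le> B * (1 - \<kappa> k x)"
        using B(2)[of x] \<kappa>(3)[of k x] by (simp add: mult_right_mono)
    qed (use int in auto)
    also have "\<dots> = B * (1 - (\<integral>x. \<kappa> k x \<partial>N))"
      using int by (simp add: N.prob_space)
    finally show ?thesis .
  qed
  have "(\<lambda>n. \<integral>x. \<kappa> k x \<partial>\<mu> n) \<longlonglongrightarrow> (\<integral>x. \<kappa> k x \<partial>\<nu>)"
    using \<kappa> by (intro compact exI[of _ "real k + 1"]) auto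
  then have "eventually (\<lambda>n. \<bar>(\<integral>x. \<kappa> k x \<partial>\<mu> n) - (\<integral>x. \<kappa> k x \<partial>\<nu>)\<bar> < r / (8 * B)) sequentially"
    using r B(1) unfolding tendsto_iff dist_real_def by simp
  moreover have "(\<lambda>n. \<integral>x. f x * \<kappa> k x \<partial>\<mu> n) \<longlonglongrightarrow> (\<integral>x. f x * \<kappa> k x \<partial>\<nu>)"
    using \<kappa> f by (intro compact continuous_on_mult exI[of _ "real k + 1"]) auto
  then have "eventually (\<lambda>n. \<bar>(\<integral>x. f x * \<kappa> k x \<partial>\<mu> n) - (\<integral>x. f x * \<kappa> k x \<partial>\<nu>)\<bar> < r / 4) sequentially"
    using r by (auto dest!: tendstoD[where e = "r / 4"] simp: dist_real_def)
  ultimately have "eventually (\<lambda>n. \<bar>(\<integral>x. f x \<partial>\<mu> n) - (\<integral>x. f x \<partial>\<nu>)\<bar> < r) sequentially"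
  proof eventually_elim
    case (elim n)
    have "1 - (\<integral>x. \<kappa> k x \<partial>\<mu> n) \<le> r / (4 * B)"
      using elim(1) k by (simp add: field_simps)
    then have "B * (1 - (\<integral>x. \<kappa> k x \<partial>\<mu> n)) \<le> r / 4" "B * (1 - (\<integral>x. \<kappa> k x \<partial>\<nu>)) < r / 8"
      using k B(1) by (simp_all add: field_simps)
    with elim(2) cut[OF \<mu>(1,2)[of n]] cut[OF \<nu>] r show ?case by linarith
  qed
  then show "\<exists>N. \<forall>n\<ge>N. norm ((\<integral>x. f x \<partial>\<mu> n) - (\<integral>x. f x \<partial>\<nu>)) < r"
    unfolding eventually_sequentially by simp
qed

section \<open>Weak convergence from convergence of moment generating functions\<close>

text \<open>
  Some coordinate of \<open>x\<close> is at least \<open>norm x / DIM('a)\<close> in absolute value, and the exponential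
  belonging to that coordinate and its sign already dominates. This is how convergence at finitely
  many points of \<open>U\<close> controls the weight.
\<close>

lemma weight_le_sum_exp:
  fixes x :: "'a::euclidean_space"
  assumes "0 < r"
  shows "exp (a \<bullet> x + r / DIM('a) * norm x)
    \<le> (\<Sum>s \<in> (\<lambda>b. a + r *\<^sub>R b) ` Basis \<union> (\<lambda>b. a - r *\<^sub>R b) ` Basis. exp (s \<bullet> x))"
    (is "_ \<le> (\<Sum>s\<in>?D. _)")
proof -
  have "\<exists>b\<in>Basis. norm x / DIM('a) \<le> \<bar>x \<bullet> b\<bar>"
  proof (rule ccontr)
    assume "\<not> ?thesis"
    then have "(\<Sum>b\<in>Basis. \<bar>x \<bullet> b\<bar>) < (\<Sum>b\<in>(Basis :: 'a set). norm x / DIM('a))"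
      by (intro sum_strict_mono) auto
    then show False using norm_le_l1[of x] by simp
  qed
  then obtain b where b: "b \<in> Basis" "norm x / DIM('a) \<le> \<bar>x \<bullet> b\<bar>" ..
  have "r / DIM('a) * norm x \<le> r * \<bar>x \<bullet> b\<bar>"
    using mult_left_mono[OF b(2), of r] assms by simp
  then have le: "a \<bullet> x + r / DIM('a) * norm x \<le> a \<bullet> x + r * \<bar>x \<bullet> b\<bar>" by simp
  define s where "s = (if x \<bullet> b < 0 then a - r *\<^sub>R b else a + r *\<^sub>R b)"
  have s_x: "s \<bullet> x = a \<bullet> x + r * \<bar>x \<bullet> b\<bar>"
    by (simp add: s_def inner_add_left inner_diff_left inner_commute[of b])
  have "exp (a \<bullet> x + r / DIM('a) * norm x) \<le> exp (s \<bullet> x)"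
    unfolding exp_le_cancel_iff using le unfolding s_x .
  also have "\<dots> \<le> (\<Sum>s\<in>?D. exp (s \<bullet> x))"
    using b(1) by (intro member_le_sum) (auto simp: s_def)
  finally show ?thesis .
qed

text \<open>
  Only from some index \<open>N\<close> on does convergence of the moment generating functions at the points of \<open>D\<close>
  bound the integrals of the weight; earlier ones may be infinite. The sequence is therefore
  shifted by \<open>N\<close>.
\<close>

lemma integral_converges_if_mgf_converges:
  fixes \<mu> :: "nat \<Rightarrow> 'a::euclidean_space measure"
  assumes \<mu>: "\<And>n. prob_space (\<mu> n)" "\<And>n. sets (\<mu> n) = sets borel"
    and \<nu>: "prob_space \<nu>" "sets \<nu> = sets borel"
    and U: "open U" "U \<noteq> {}"
    and fin: "\<And>s. s \<in> U \<Longrightarrow> mgf \<nu> (\<lambda>x. x) s < \<infinity>"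
    and lim: "\<And>s. s \<in> U \<Longrightarrow> (\<lambda>n. mgf (\<mu> n) (\<lambda>x. x) s) \<longlonglongrightarrow> mgf \<nu> (\<lambda>x. x) s"
    and f: "continuous_on UNIV f" "bounded (range f)"
  shows "(\<lambda>n. \<integral>x. f x \<partial>\<mu> n) \<longlonglongrightarrow> (\<integral>x. f x \<partial>\<nu> :: real)"
proof -
  note [measurable_cong] = \<mu>(2) \<nu>(2)
  obtain a e where e: "0 < e" "ball a e \<subseteq> U"
    using U by (meson ex_in_conv openE)
  define r where "r = e / 2"
  define \<rho> where "\<rho> = r / DIM('a)"
  have r: "0 < r" "r < e" and \<rho>: "0 < \<rho>" "\<rho> \<le> r"
    using e by (auto simp: r_def \<rho>_def divide_le_eq Suc_le_eq)
  define D where "D = (\<lambda>b. a + r *\<^sub>R b) ` Basis \<union> (\<lambda>b. a - r *\<^sub>R b) ` Basis"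
  have D: "finite D" "D \<subseteq> U"
    using r e by (auto simp: D_def dist_norm subset_iff)
  define W where "W x = exp (a \<bullet> x + \<rho> * norm x)" for x
  have W [measurable]: "W \<in> borel_measurable borel"
    unfolding W_def by (intro borel_measurable_continuous_onI continuous_intros)
  have nn_W: "(\<integral>\<^sup>+x. ennreal (W x) \<partial>N) \<le> (\<Sum>s\<in>D. mgf N (\<lambda>x. x) s)" if [measurable_cong]: "sets N = sets borel" for N
  proof -
    have "(\<integral>\<^sup>+x. ennreal (W x) \<partial>N) \<le> (\<integral>\<^sup>+x. (\<Sum>s\<in>D. ennreal (exp (s \<bullet> x))) \<partial>N)"
      unfolding W_def \<rho>_def D_def sum_ennreal[OF exp_ge_zero]
      by (intro nn_integral_mono ennreal_leI weight_le_sum_exp r)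
    also have "\<dots> = (\<Sum>s\<in>D. mgf N (\<lambda>x. x) s)"
      unfolding mgf_def by (intro nn_integral_sum) measurable
    finally show ?thesis .
  qed
  define c where "c = (\<Sum>s\<in>D. mgf \<nu> (\<lambda>x. x) s)"
  have c: "c < \<infinity>"
    using D fin unfolding c_def by (auto simp: ennreal_sum_less_top)
  have "(\<lambda>n. \<Sum>s\<in>D. mgf (\<mu> n) (\<lambda>x. x) s) \<longlonglongrightarrow> c"
    unfolding c_def using D lim by (intro tendsto_sum) auto
  then have "eventually (\<lambda>n. (\<Sum>s\<in>D. mgf (\<mu> n) (\<lambda>x. x) s) < c + 1) sequentially"
    using c by (intro order_tendstoD(2)) (auto simp: ennreal_add_less_top less_top)
  then obtain N where N: "\<And>n. N \<le> n \<Longrightarrow> (\<Sum>s\<in>D. mgf (\<mu> n) (\<lambda>x. x) s) < c + 1"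
    unfolding eventually_sequentially by blast
  have W_int: "integrable P W \<and> (\<integral>x. W x \<partial>P) \<le> enn2real (c + 1)"
    if P: "sets P = sets borel" and le: "(\<Sum>s\<in>D. mgf P (\<lambda>x. x) s) \<le> c + 1" for P
  proof
    note [measurable_cong] = P
    have fin: "c + 1 < \<infinity>" using c by simp
    have le: "(\<integral>\<^sup>+x. ennreal (W x) \<partial>P) \<le> c + 1" using nn_W[OF P] le by (rule order_trans)
    show "integrable P W"
      using le_less_trans[OF le fin] by (intro integrableI_nonneg) (auto simp: W_def)
    have "(\<integral>x. W x \<partial>P) = enn2real (\<integral>\<^sup>+x. ennreal (W x) \<partial>P)"
      by (intro integral_eq_nn_integral) (auto simp: W_def)
    also have "\<dots> \<le> enn2real (c + 1)"
      using le fin by (intro enn2real_mono) auto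
    finally show "(\<integral>x. W x \<partial>P) \<le> enn2real (c + 1)" .
  qed
  interpret exponential_moments "\<lambda>n. \<mu> (n + N)" \<nu> a \<rho> "enn2real (c + 1)"
  proof
    have "(\<Sum>s\<in>D. mgf (\<mu> (n + N)) (\<lambda>x. x) s) \<le> c + 1" for n
      using N[of "n + N"] by simp
    from W_int[OF \<mu>(2) this]
    show "integrable (\<mu> (n + N)) (\<lambda>x. exp (a \<bullet> x + \<rho> * norm x))"
      "(\<integral>x. exp (a \<bullet> x + \<rho> * norm x) \<partial>\<mu> (n + N)) \<le> enn2real (c + 1)" for n
      unfolding W_def by auto
    have "(\<Sum>s\<in>D. mgf \<nu> (\<lambda>x. x) s) \<le> c + 1" unfolding c_def by simp
    from W_int[OF \<nu>(2) this]
    show "integrable \<nu> (\<lambda>x. exp (a \<bullet> x + \<rho> * norm x))"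
      "(\<integral>x. exp (a \<bullet> x + \<rho> * norm x) \<partial>\<nu>) \<le> enn2real (c + 1)"
      unfolding W_def by auto
    fix s assume "dist a s < \<rho>"
    then have s: "s \<in> U" using e r \<rho> by auto
    have mgf_real: "(\<integral>x. exp (s \<bullet> x) \<partial>P) = enn2real (mgf P (\<lambda>x. x) s)" if [measurable_cong]: "sets P = sets borel" for P
      unfolding mgf_def by (intro integral_eq_nn_integral) auto
    have "(\<lambda>n. enn2real (mgf (\<mu> n) (\<lambda>x. x) s)) \<longlonglongrightarrow> enn2real (mgf \<nu> (\<lambda>x. x) s)"
      using lim[OF s] fin[OF s] by (intro tendsto_enn2real) auto
    then show "(\<lambda>n. \<integral>x. exp (s \<bullet> x) \<partial>\<mu> (n + N)) \<longlonglongrightarrow> (\<integral>x. exp (s \<bullet> x) \<partial>\<nu>)"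
      unfolding mgf_real[OF \<mu>(2)] mgf_real[OF \<nu>(2)] by (rule LIMSEQ_ignore_initial_segment)
  qed (use \<mu> \<nu> \<rho> in auto)
  show ?thesis
  proof (rule integral_converges_if_compact_support[OF \<mu> \<nu> _ f])
    fix g :: "'a \<Rightarrow> real" assume g: "continuous_on UNIV g" "\<exists>R. \<forall>x. R \<le> norm x \<longrightarrow> g x = 0"
    then obtain R where R: "\<And>x. R \<le> norm x \<Longrightarrow> g x = 0" by blast
    have "bounded ((\<lambda>x. g x * exp (- (a \<bullet> x))) ` cball 0 R)"
      using g(1) by (intro compact_imp_bounded compact_continuous_image continuous_intros)
        (auto intro: continuous_on_subset)
    then obtain B where B: "0 < B" "\<And>x. norm x \<le> R \<Longrightarrow> \<bar>g x * exp (- (a \<bullet> x))\<bar> \<le> B"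
      unfolding bounded_pos by auto
    have "\<bar>g x\<bar> \<le> B * exp (a \<bullet> x)" for x
      using B R[of x] by (cases "norm x \<le> R") (auto simp: abs_mult exp_minus field_simps)
    then have "(\<lambda>n. \<integral>x. g x \<partial>\<mu> (n + N)) \<longlonglongrightarrow> (\<integral>x. g x \<partial>\<nu>)"
      by (rule integral_converges_if_tilt_bounded[OF g(1)])
    then show "(\<lambda>n. \<integral>x. g x \<partial>\<mu> n) \<longlonglongrightarrow> (\<integral>x. g x \<partial>\<nu>)"
      by (rule LIMSEQ_offset)
  qed
qed

lemma mgf_distr:
  fixes X :: "'w \<Rightarrow> 'v::euclidean_space"
  assumes "X \<in> borel_measurable M"
  shows "mgf (distr M borel X) (\<lambda>x. x) s = mgf M X s"
  unfolding mgf_def using assms by (simp add: nn_integral_distr)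

theorem proposition2p2:
  fixes M :: "enat \<Rightarrow> 'w measure"
    and X :: "enat \<Rightarrow> 'w \<Rightarrow> real ^ 'd"
    and U :: "(real ^ 'd) set"
  assumes "\<And>n. prob_space (M n)"
    and "\<And>n. X n \<in> borel_measurable (M n)"
    and "open U" and "U \<noteq> {}"
    and "\<And>s. s \<in> U \<Longrightarrow> mgf (M \<infinity>) (X \<infinity>) s < \<infinity>"
    and "\<And>s. s \<in> U \<Longrightarrow> (\<lambda>n. mgf (M (enat n)) (X (enat n)) s) \<longlonglongrightarrow> mgf (M \<infinity>) (X \<infinity>) s"
  shows "converges_in_distribution (\<lambda>n. M (enat n)) (\<lambda>n. X (enat n)) (M \<infinity>) (X \<infinity>)"
  unfolding converges_in_distribution_def
proof (intro allI impI)
  fix f :: "real ^ 'd \<Rightarrow> real" assume f: "continuous_on UNIV f" "bounded (range f)"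
  define law where "law n = distr (M n) borel (X n)" for n
  have law: "prob_space (law n)" "sets (law n) = sets borel" for n
    using prob_space.prob_space_distr[OF assms(1,2)] by (auto simp: law_def)
  have "mgf (law n) (\<lambda>x. x) s = mgf (M n) (X n) s" for n s
    unfolding law_def by (rule mgf_distr[OF assms(2)])
  then have "(\<lambda>n. \<integral>x. f x \<partial>law (enat n)) \<longlonglongrightarrow> (\<integral>x. f x \<partial>law \<infinity>)"
    using assms(5,6) by (intro integral_converges_if_mgf_converges[OF law law assms(3,4) _ _ f]) auto
  moreover have "(\<integral>x. f x \<partial>law n) = (\<integral>w. f (X n w) \<partial>M n)" for n
    unfolding law_def using f(1) by (intro integral_distr assms(2) borel_measurable_continuous_onI)
  ultimately show "(\<lambda>n. \<integral>w. f (X (enat n) w) \<partial>M (enat n)) \<longlonglongrightarrow> (\<integral>w. f (X \<infinity> w) \<partial>M \<infinity>)"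
    by simp
qed

end
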